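(* Let $\nu$ be a lattice path from $(0,0)$ to $(\ell-n,n)$, and let $\mathrm{Tam}(\nu)$ be the $\nu$-Tamari lattice, viewed as the lattice of $\nu$-bracket vectors under the componentwise order. For every $\mathsf b\in\mathrm{Tam}(\nu)$, \[\mathrm{Row}(\mathsf b)=(\Theta_\ell\circ\cdots\circ\Theta_1\circ\Theta_0)(\mathsf b).\]
   Context: Intervals are integer intervals: $[a,b]=\{a,\dots,b\}$ (empty if $a>b$). Vectors are indexed from $0$. A lattice path uses unit north and unit east steps and starts at the origin. $\nu$-bracket vectors. Let $(b_0(\nu),\dots,b_\ell(\nu))$ be the heights ($y$-coordinates) of the lattice points of $\nu$ in the order they appear on $\nu$. For $0\le k\le n$, let $f_k$ be the largest index with $b_{f_k}(\nu)=k$; $f_0,\dots,f_n$ are the fixed positions of $\nu$. A $\nu$-bracket vector is an integer vector $\mathsf b=(\mathsf b_0,\dots,\mathsf b_\ell)$ such that (I) $\mathsf b_{f_k}=k$ for all $k\in[0,n]$; (II) $b_i(\nu)\le\mathsf b_i\le n$ for all $i\in[0,\ell]$; (III) if $\mathsf b_i=k$, then $\mathsf b_j\le k$ for all $j\in[i+1,f_k]$. The set $\mathrm{Tam}(\nu)$ of these, ordered componentwise, is a finite semidistributive lattice with meet the componentwise minimum. Rowmotion on a finite semidistributive lattice $L$. An element $j$ is join-irreducible if it covers exactly one element, denoted $j_*$; for such $j$, the set $\{z\in L:z\wedge j=j_*\}$ has a maximum, denoted $\kappa(j)$. For each cover relation $x\lessdot y$ there is a unique join-irreducible $j_{xy}$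 with $j_{xy}\le y$ and $\kappa(j_{xy})\ge x$. Put $\mathcal D(z)=\{j_{xz}:x\lessdot z\}$ and $\mathcal U(z)=\{j_{zy}:z\lessdot y\}$. For each $x\in L$ there is a unique element $\mathrm{Row}(x)\in L$ with $\mathcal U(\mathrm{Row}(x))=\mathcal D(x)$. The maps $\Theta_r$. For $\mathsf b\in\mathrm{Tam}(\nu)$ let $\Delta(\mathsf b)=\{i\in[0,\ell-1]:\mathsf b_i>\mathsf b_{i+1}\}$. For $i\in[0,\ell]$ let $\zeta_i(\mathsf b)=\min\{\mathsf b_j:j\in[0,i-1],\ \mathsf b_j\ge\mathsf b_i\}$, with $\zeta_i(\mathsf b)=n$ if this set is empty. For $i\in\Delta(\mathsf b)$ let $\eta_i(\mathsf b)=\max\{h\in[b_i(\nu),\mathsf b_i-1]:\mathsf b_j\le h\text{ for all }j\in[i+1,f_h]\}$ (this set is nonempty). Write $\mathsf b\leftarrow_i t$ for the vector obtained from $\mathsf b$ by replacing the entry in position $i$ by $t$. For $r\in[0,\ell]$, $\Theta_r\colon\mathrm{Tam}(\nu)\to\mathrm{Tam}(\nu)$ is defined by: $\Theta_r(\mathsf b)=\mathsf b$ if $r\in\{f_0,\dots,f_n\}$; $\Theta_r(\mathsf b)=\mathsf b\leftarrow_r\eta_r(\mathsf b)$ if $r\in\Delta(\mathsf b)$; $\Theta_r(\mathsf b)=\mathsf b\leftarrow_r\zeta_r(\mathsf b)$ if $r\notin\{f_0,\dots,f_n\}$ and $r\notin\Delta(\mathsf b)$. (No fixed position lies in $\Delta(\mathsf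 b)$.) *)

theory Defs
  imports "HOL-Algebra.Lattice"
begin

text \<open>
  Rowmotion and its ingredients are meant for a finite semidistributive lattice \<open>L\<close>, given as an
  HOL-Algebra order record. They are total functions; each description operator \<open>THE\<close> picks the
  object whose unique existence is guaranteed by semidistributivity.
\<close>

definition covered_by :: "('a, 'c) gorder_scheme \<Rightarrow> 'a \<Rightarrow> 'a \<Rightarrow> bool" where
  "covered_by L x y \<longleftrightarrow> x \<in> carrier L \<and> y \<in> carrier L \<and> x \<sqsubset>\<^bsub>L\<^esub> y \<and>
     (\<nexists>z. z \<in> carrier L \<and> x \<sqsubset>\<^bsub>L\<^esub> z \<and> z \<sqsubset>\<^bsub>L\<^esub> y)"

definition join_irreducible :: "('a, 'c) gorder_scheme \<Rightarrow> 'a \<Rightarrow> bool" where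
  "join_irreducible L j \<longleftrightarrow> j \<in> carrier L \<and> (\<exists>!x. covered_by L x j)"

definition lower_star :: "('a, 'c) gorder_scheme \<Rightarrow> 'a \<Rightarrow> 'a" where
  "lower_star L j = (THE x. covered_by L x j)"

definition kappa :: "('a, 'c) gorder_scheme \<Rightarrow> 'a \<Rightarrow> 'a" where
  "kappa L j = (THE m. greatest L m {z \<in> carrier L. z \<sqinter>\<^bsub>L\<^esub> j = lower_star L j})"

definition edge_label :: "('a, 'c) gorder_scheme \<Rightarrow> 'a \<Rightarrow> 'a \<Rightarrow> 'a" where
  "edge_label L x y =
     (THE j. join_irreducible L j \<and> j \<sqsubseteq>\<^bsub>L\<^esub> y \<and> x \<sqsubseteq>\<^bsub>L\<^esub> kappa L j)"

definition down_labels :: "('a, 'c) gorder_scheme \<Rightarrow> 'a \<Rightarrow> 'a set" where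
  "down_labels L z = {edge_label L x z | x. covered_by L x z}"

definition up_labels :: "('a, 'c) gorder_scheme \<Rightarrow> 'a \<Rightarrow> 'a set" where
  "up_labels L z = {edge_label L z y | y. covered_by L z y}"

definition Row :: "('a, 'c) gorder_scheme \<Rightarrow> 'a \<Rightarrow> 'a" where
  "Row L x = (THE y. y \<in> carrier L \<and> up_labels L y = down_labels L x)"

datatype step = North | East

type_synonym path = "step list"

definition lattice_point :: "path \<Rightarrow> nat \<Rightarrow> nat \<times> nat" where
  "lattice_point \<nu> i = (count_list (take i \<nu>) East, count_list (take i \<nu>) North)"

definition height :: "path \<Rightarrow> nat \<Rightarrow> nat" where
  "height \<nu> i = snd (lattice_point \<nu> i)"

text \<open>
  A path from \<open>(0,0)\<close> to \<open>(\<ell> - n, n)\<close> has \<open>\<ell> = length \<nu>\<close> steps (hence \<open>\<ell> + 1\<close> lattice points)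
  and \<open>n = height \<nu> (length \<nu>)\<close>.
\<close>

abbreviation top_height :: "path \<Rightarrow> nat" where
  "top_height \<nu> \<equiv> height \<nu> (length \<nu>)"

definition fixed_position :: "path \<Rightarrow> nat \<Rightarrow> nat" where
  "fixed_position \<nu> k = Max {i. i \<le> length \<nu> \<and> height \<nu> i = k}"

text \<open>
  Vectors are lists. Natural-number entries lose no generality over integer entries, because
  every entry is bounded below by a height of \<open>\<nu>\<close>.
\<close>

definition bracket_vector :: "path \<Rightarrow> nat list \<Rightarrow> bool" where
  "bracket_vector \<nu> b \<longleftrightarrow>
     length b = length \<nu> + 1 \<and>
     (\<forall>k \<le> top_height \<nu>. b ! fixed_position \<nu> k = k) \<and>
     (\<forall>i \<le> length \<nu>. height \<nu> i \<le> b ! i \<and> b ! i \<le> top_height \<nu>) \<and>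
     (\<forall>i \<le> length \<nu>. \<forall>k. b ! i = k \<longrightarrow> (\<forall>j \<in> {i + 1..fixed_position \<nu> k}. b ! j \<le> k))"

definition Tam :: "path \<Rightarrow> nat list gorder" where
  "Tam \<nu> = \<lparr>carrier = {b. bracket_vector \<nu> b}, eq = (=), le = list_all2 (\<le>)\<rparr>"

definition descents :: "path \<Rightarrow> nat list \<Rightarrow> nat set" where
  "descents \<nu> b = {i. i < length \<nu> \<and> b ! i > b ! (i + 1)}"

definition zeta :: "path \<Rightarrow> nat \<Rightarrow> nat list \<Rightarrow> nat" where
  "zeta \<nu> i b =
     (let S = {b ! j | j. j < i \<and> b ! j \<ge> b ! i}
      in if S = {} then top_height \<nu> else Min S)"

definition eta :: "path \<Rightarrow> nat \<Rightarrow> nat list \<Rightarrow> nat" where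
  "eta \<nu> i b =
     Max {h \<in> {height \<nu> i..<b ! i}. \<forall>j \<in> {i + 1..fixed_position \<nu> h}. b ! j \<le> h}"

definition Theta :: "path \<Rightarrow> nat \<Rightarrow> nat list \<Rightarrow> nat list" where
  "Theta \<nu> r b =
     (if r \<in> fixed_position \<nu> ` {0..top_height \<nu>} then b
      else if r \<in> descents \<nu> b then b[r := eta \<nu> r b]
      else b[r := zeta \<nu> r b])"

end

theory Submission
  imports Defs
begin

text \<open>
  A cover relation in \<open>Tam \<nu>\<close> changes a single entry: the lower covers of \<open>b\<close> lower the entry at a
  descent \<open>i\<close> to \<open>\<eta>\<^sub>i(b)\<close>. The join-irreducibles are the least bracket vectors with a prescribed
  entry \<open>t\<close> at a non-fixed position \<open>i\<close>, and the label of a cover that changes the entry at \<open>i\<close>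
  from \<open>s\<close> upwards is the one with parameters \<open>(i, s + 1)\<close>. Hence the down-labels of \<open>b\<close> record the
  pairs \<open>(i, \<eta>\<^sub>i(b))\<close> for descents \<open>i\<close>, and the up-labels of \<open>y\<close> record the pairs \<open>(i, y\<^sub>i)\<close> for
  those non-fixed \<open>i\<close> with \<open>y\<^sub>i < n\<close> whose entry does not occur further left. The up-labels determine
  \<open>y\<close> by recursion from the left. In the composition of the \<open>\<Theta>\<^sub>r\<close>, the value \<open>\<eta>\<^sub>r\<close> only depends on
  entries not yet touched, while \<open>\<zeta>\<^sub>r\<close> is \<open>n\<close> or an entry already finalised further left; so the result
  has exactly the required up-labels.
\<close>

section \<open>Heights along a path and fixed positions\<close>

lemma height_0: "height \<nu> 0 = 0"
  by (simp add: height_def lattice_point_def)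

lemma height_Suc:
  "i < length \<nu> \<Longrightarrow> height \<nu> (Suc i) = height \<nu> i + (if \<nu> ! i = North then 1 else 0)"
  by (simp add: height_def lattice_point_def take_Suc_conv_app_nth)

lemma height_mono:
  assumes "i \<le> j"
  shows "height \<nu> i \<le> height \<nu> j"
proof -
  obtain d where "j = i + d"
    using assms le_Suc_ex by blast
  then show ?thesis
    by (simp add: height_def lattice_point_def take_add)
qed

lemma height_surj:
  "k \<le> height \<nu> m \<Longrightarrow> m \<le> length \<nu> \<Longrightarrow> \<exists>i\<le>m. height \<nu> i = k"
proof (induction m)
  case 0
  then show ?case by (simp add: height_0)
next
  case (Suc m)
  show ?case
  proof (cases "k \<le> height \<nu> m")
    case True
    then show ?thesis using Suc by (meson Suc_leD le_SucI)
  next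
    case False
    then have "height \<nu> (Suc m) = k"
      using Suc.prems height_Suc[of m \<nu>] by (auto split: if_splits)
    then show ?thesis by blast
  qed
qed

lemma fixed_position_props:
  assumes "k \<le> top_height \<nu>"
  shows "fixed_position \<nu> k \<le> length \<nu>" "height \<nu> (fixed_position \<nu> k) = k"
proof -
  let ?S = "{i. i \<le> length \<nu> \<and> height \<nu> i = k}"
  have "finite ?S" by simp
  moreover have "?S \<noteq> {}"
    using height_surj[OF assms order_refl] by blast
  ultimately have "Max ?S \<in> ?S" by (rule Max_in)
  then show "fixed_position \<nu> k \<le> length \<nu>" "height \<nu> (fixed_position \<nu> k) = k"
    by (auto simp: fixed_position_def)
qed

text \<open>Heights are weakly increasing, so an interval ending at a fixed position is cut out by a
  bound on heights. This lets later arguments speak of heights instead of the \<open>Max\<close> in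
  the definition.\<close>

lemma le_fixed_position_iff:
  assumes "k \<le> top_height \<nu>" "i \<le> length \<nu>"
  shows "i \<le> fixed_position \<nu> k \<longleftrightarrow> height \<nu> i \<le> k"
proof
  assume "i \<le> fixed_position \<nu> k"
  then show "height \<nu> i \<le> k"
    using height_mono fixed_position_props(2)[OF assms(1)] by metis
next
  assume le: "height \<nu> i \<le> k"
  show "i \<le> fixed_position \<nu> k"
  proof (rule ccontr)
    assume gt: "\<not> i \<le> fixed_position \<nu> k"
    then have "height \<nu> i = k"
      using le height_mono[of "fixed_position \<nu> k" i \<nu>] fixed_position_props(2)[OF assms(1)] by auto
    then have "i \<le> fixed_position \<nu> k"
      unfolding fixed_position_def using assms by (intro Max_ge) auto
    then show False using gt by simp
  qed
qed

definition fixed_positions :: "path \<Rightarrow> nat set" where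
  "fixed_positions \<nu> = fixed_position \<nu> ` {0..top_height \<nu>}"

text \<open>The points of one height form a run of east steps, and the fixed position is its last
  point; so a north step or the end of the path follows.\<close>

lemma mem_fixed_positions_iff:
  assumes "i \<le> length \<nu>"
  shows "i \<in> fixed_positions \<nu> \<longleftrightarrow> i = length \<nu> \<or> height \<nu> (Suc i) \<noteq> height \<nu> i"
proof -
  let ?k = "height \<nu> i"
  have k: "?k \<le> top_height \<nu>"
    using assms height_mono by blast
  have "i \<in> fixed_positions \<nu> \<longleftrightarrow> i = fixed_position \<nu> ?k"
    using k fixed_position_props(2) by (auto simp: fixed_positions_def)
  also have "\<dots> \<longleftrightarrow> fixed_position \<nu> ?k \<le> i"
    using le_fixed_position_iff[OF k assms] by auto
  also have "\<dots> \<longleftrightarrow> i = length \<nu> \<or> height \<nu> (Suc i) \<noteq> ?k"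
  proof (cases "i = length \<nu>")
    case True
    then show ?thesis using fixed_position_props(1)[OF k] by simp
  next
    case False
    then have "Suc i \<le> fixed_position \<nu> ?k \<longleftrightarrow> height \<nu> (Suc i) \<le> ?k"
      using le_fixed_position_iff[OF k, of "Suc i"] assms by simp
    then show ?thesis
      using False height_mono[of i "Suc i" \<nu>] by auto
  qed
  finally show ?thesis .
qed

lemma not_fixedD:
  assumes "i \<le> length \<nu>" "i \<notin> fixed_positions \<nu>"
  shows "i < length \<nu>" "height \<nu> (Suc i) = height \<nu> i"
  using assms mem_fixed_positions_iff by (auto simp: le_less)

lemma not_fixed_if_height_eq:
  assumes "j < i" "i \<le> length \<nu>" "height \<nu> j = height \<nu> i"
  shows "j \<notin> fixed_positions \<nu>"
proof -
  have "height \<nu> (Suc j) = height \<nu> j"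
    using height_mono[of j "Suc j" \<nu>] height_mono[of "Suc j" i \<nu>] assms by simp
  then show ?thesis
    using assms by (subst mem_fixed_positions_iff) auto
qed

section \<open>Bracket vectors in terms of heights\<close>

text \<open>Trades the intervals ending at fixed positions for conditions on heights, the form used
  from here on.\<close>

lemma bracket_vector_iff:
  "bracket_vector \<nu> b \<longleftrightarrow>
     length b = length \<nu> + 1 \<and>
     (\<forall>i\<le>length \<nu>. height \<nu> i \<le> b ! i \<and> b ! i \<le> top_height \<nu>) \<and>
     (\<forall>i\<le>length \<nu>. i \<in> fixed_positions \<nu> \<longrightarrow> b ! i = height \<nu> i) \<and>
     (\<forall>i j. i < j \<longrightarrow> j \<le> length \<nu> \<longrightarrow> height \<nu> j \<le> b ! i \<longrightarrow> b ! j \<le> b ! i)"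
  (is "_ \<longleftrightarrow> ?len \<and> ?bounds \<and> ?fixed \<and> ?nested")
proof -
  have fixed: "(\<forall>k\<le>top_height \<nu>. b ! fixed_position \<nu> k = k) \<longleftrightarrow> ?fixed"
    using fixed_position_props by (auto simp: fixed_positions_def)
  have nested: "(\<forall>i\<le>length \<nu>. \<forall>k. b ! i = k \<longrightarrow> (\<forall>j\<in>{i + 1..fixed_position \<nu> k}. b ! j \<le> k))
      \<longleftrightarrow> ?nested" if bounds: ?bounds
  proof -
    have "j \<in> {i + 1..fixed_position \<nu> (b ! i)} \<longleftrightarrow>
        i < j \<and> j \<le> length \<nu> \<and> height \<nu> j \<le> b ! i" if "i \<le> length \<nu>" for i j
      using le_fixed_position_iff[of "b ! i" \<nu> j] fixed_position_props(1)[of "b ! i" \<nu>] bounds that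
      by auto
    then show ?thesis
      by (meson less_le_trans less_imp_le)
  qed
  show ?thesis
    unfolding bracket_vector_def fixed using nested by argo
qed

lemma bracket_vectorD:
  assumes "bracket_vector \<nu> b"
  shows "length b = length \<nu> + 1"
    and "i \<le> length \<nu> \<Longrightarrow> height \<nu> i \<le> b ! i"
    and "i \<le> length \<nu> \<Longrightarrow> b ! i \<le> top_height \<nu>"
    and "i \<le> length \<nu> \<Longrightarrow> i \<in> fixed_positions \<nu> \<Longrightarrow> b ! i = height \<nu> i"
    and "i < j \<Longrightarrow> j \<le> length \<nu> \<Longrightarrow> height \<nu> j \<le> b ! i \<Longrightarrow> b ! j \<le> b ! i"
  using assms unfolding bracket_vector_iff by blast+

text \<open>A nesting condition meets position \<open>i\<close> either as its left end, with bound
  \<open>t\<close>, or as its right end, with bound \<open>b ! j\<close>; \<open>right\<close> and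
  \<open>left\<close> treat these two cases.\<close>

lemma bracket_vector_update:
  assumes b: "bracket_vector \<nu> b"
    and i: "i \<le> length \<nu>" "i \<notin> fixed_positions \<nu>"
    and t: "height \<nu> i \<le> t" "t \<le> top_height \<nu>"
    and right: "\<And>j. i < j \<Longrightarrow> j \<le> length \<nu> \<Longrightarrow> height \<nu> j \<le> t \<Longrightarrow> b ! j \<le> t"
    and left: "\<And>j. j < i \<Longrightarrow> height \<nu> i \<le> b ! j \<Longrightarrow> t \<le> b ! j"
  shows "bracket_vector \<nu> (b[i := t])"
  using i t left right bracket_vectorD[OF b]
  unfolding bracket_vector_iff by (auto simp: nth_list_update)

lemma bracket_vector_nth_Suc_le:
  assumes b: "bracket_vector \<nu> b" and i: "i \<le> length \<nu>" "i \<notin> fixed_positions \<nu>"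
  shows "b ! Suc i \<le> b ! i"
  using bracket_vectorD(5)[OF b, of i "Suc i"] bracket_vectorD(2)[OF b, of i] not_fixedD[OF i] i
  by simp

lemma descents_not_fixed:
  assumes b: "bracket_vector \<nu> b" and i: "i \<in> descents \<nu> b"
  shows "i \<le> length \<nu>" "i \<notin> fixed_positions \<nu>"
proof -
  from i have lt: "i < length \<nu>" "b ! Suc i < b ! i"
    by (auto simp: descents_def)
  then show "i \<le> length \<nu>" by simp
  have "height \<nu> i \<le> height \<nu> (Suc i)" by (simp add: height_mono)
  then show "i \<notin> fixed_positions \<nu>"
    using lt bracket_vectorD(2)[OF b, of "Suc i"] bracket_vectorD(4)[OF b, of i] by fastforce
qed

section \<open>The replacement values eta and zeta\<close>

lemma eta_props:
  assumes b: "bracket_vector \<nu> b" and i: "i \<in> descents \<nu> b"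
  shows "height \<nu> i \<le> eta \<nu> i b" "eta \<nu> i b < b ! i"
    and "\<And>j. i < j \<Longrightarrow> j \<le> length \<nu> \<Longrightarrow> height \<nu> j \<le> eta \<nu> i b \<Longrightarrow> b ! j \<le> eta \<nu> i b"
    and "\<And>h. height \<nu> i \<le> h \<Longrightarrow> h < b ! i \<Longrightarrow>
           (\<And>j. i < j \<Longrightarrow> j \<le> length \<nu> \<Longrightarrow> height \<nu> j \<le> h \<Longrightarrow> b ! j \<le> h) \<Longrightarrow> h \<le> eta \<nu> i b"
proof -
  let ?S = "{h \<in> {height \<nu> i..<b ! i}. \<forall>j\<in>{i + 1..fixed_position \<nu> h}. b ! j \<le> h}"
  note nf = descents_not_fixed[OF b i]
  have S: "h \<in> ?S \<longleftrightarrow> height \<nu> i \<le> h \<and> h < b ! i \<and>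
      (\<forall>j. i < j \<longrightarrow> j \<le> length \<nu> \<longrightarrow> height \<nu> j \<le> h \<longrightarrow> b ! j \<le> h)" for h
  proof (cases "h < b ! i")
    case True
    then have "h \<le> top_height \<nu>"
      using bracket_vectorD(3)[OF b nf(1)] by simp
    then have "j \<in> {i + 1..fixed_position \<nu> h} \<longleftrightarrow> i < j \<and> j \<le> length \<nu> \<and> height \<nu> j \<le> h" for j
      using le_fixed_position_iff[of h \<nu> j] fixed_position_props(1)[of h \<nu>] by auto
    then have "(\<forall>j\<in>{i + 1..fixed_position \<nu> h}. b ! j \<le> h) \<longleftrightarrow>
        (\<forall>j. i < j \<longrightarrow> j \<le> length \<nu> \<longrightarrow> height \<nu> j \<le> h \<longrightarrow> b ! j \<le> h)"
      by blast
    then show ?thesis using True by simp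
  qed simp
  \<comment> \<open>The next entry is always a candidate: nesting at \<open>Suc i\<close> bounds the
    entries further right, and the descent makes it smaller than \<open>b ! i\<close>.\<close>
  have "b ! Suc i \<in> ?S"
  proof -
    have "b ! j \<le> b ! Suc i" if "i < j" "j \<le> length \<nu>" "height \<nu> j \<le> b ! Suc i" for j
      using that bracket_vectorD(5)[OF b, of "Suc i" j] by (cases "j = Suc i") auto
    then show ?thesis
      unfolding S using i not_fixedD[OF nf] bracket_vectorD(2)[OF b, of "Suc i"]
      by (auto simp: descents_def)
  qed
  then have ne: "?S \<noteq> {}" by blast
  have fin: "finite ?S" by simp
  have "eta \<nu> i b \<in> ?S"
    unfolding eta_def using fin ne by (rule Max_in)
  then show "height \<nu> i \<le> eta \<nu> i b" "eta \<nu> i b < b ! i"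
    "\<And>j. i < j \<Longrightarrow> j \<le> length \<nu> \<Longrightarrow> height \<nu> j \<le> eta \<nu> i b \<Longrightarrow> b ! j \<le> eta \<nu> i b"
    unfolding S by blast+
  fix h assume "height \<nu> i \<le> h" "h < b ! i"
    "\<And>j. i < j \<Longrightarrow> j \<le> length \<nu> \<Longrightarrow> height \<nu> j \<le> h \<Longrightarrow> b ! j \<le> h"
  then have "h \<in> ?S" unfolding S by blast
  then show "h \<le> eta \<nu> i b"
    unfolding eta_def using fin by (rule Max_ge[rotated])
qed

text \<open>To the right, the definition of \<open>eta\<close> gives nesting; to the left, an entry
  whose range covers \<open>i\<close> is at least \<open>b ! i\<close>, which exceeds the new
  value.\<close>

lemma bracket_vector_eta:
  assumes b: "bracket_vector \<nu> b" and i: "i \<in> descents \<nu> b"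
  shows "bracket_vector \<nu> (b[i := eta \<nu> i b])"
proof (rule bracket_vector_update[OF b descents_not_fixed[OF b i]])
  note nf = descents_not_fixed[OF b i]
  show "height \<nu> i \<le> eta \<nu> i b" by (rule eta_props(1)[OF b i])
  show "eta \<nu> i b \<le> top_height \<nu>"
    using eta_props(2)[OF b i] bracket_vectorD(3)[OF b nf(1)] by simp
  show "b ! j \<le> eta \<nu> i b" if "i < j" "j \<le> length \<nu>" "height \<nu> j \<le> eta \<nu> i b" for j
    using that by (rule eta_props(3)[OF b i])
  show "eta \<nu> i b \<le> b ! j" if "j < i" "height \<nu> i \<le> b ! j" for j
    using eta_props(2)[OF b i] bracket_vectorD(5)[OF b that(1) nf(1) that(2)] by simp
qed

lemma zeta_props:
  assumes b: "bracket_vector \<nu> b" and i: "i \<le> length \<nu>"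
  shows "b ! i \<le> zeta \<nu> i b" "zeta \<nu> i b \<le> top_height \<nu>"
    and "zeta \<nu> i b = top_height \<nu> \<or> (\<exists>j<i. zeta \<nu> i b = b ! j)"
    and "\<And>j. j < i \<Longrightarrow> b ! i \<le> b ! j \<Longrightarrow> zeta \<nu> i b \<le> b ! j"
proof -
  let ?S = "{b ! j | j. j < i \<and> b ! j \<ge> b ! i}"
  have fin: "finite ?S" by simp
  have z: "zeta \<nu> i b = (if ?S = {} then top_height \<nu> else Min ?S)"
    by (simp add: zeta_def Let_def)
  have empty: "zeta \<nu> i b = top_height \<nu>" if "?S = {}"
    using z if_P[OF that] by (rule trans)
  have nonempty: "zeta \<nu> i b = Min ?S" if "?S \<noteq> {}"
    using z if_not_P[OF that] by (rule trans)
  have alt: "zeta \<nu> i b = top_height \<nu> \<or> zeta \<nu> i b \<in> ?S"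
  proof (cases "?S = {}")
    case True
    then show ?thesis using empty by blast
  next
    case False
    then show ?thesis using Min_in[OF fin False] nonempty[OF False] by argo
  qed
  then show "zeta \<nu> i b = top_height \<nu> \<or> (\<exists>j<i. zeta \<nu> i b = b ! j)" by blast
  show "b ! i \<le> zeta \<nu> i b"
    using alt bracket_vectorD(3)[OF b i] by auto
  show "zeta \<nu> i b \<le> top_height \<nu>"
    using alt bracket_vectorD(3)[OF b] i by auto
  fix j assume "j < i" "b ! i \<le> b ! j"
  then have mem: "b ! j \<in> ?S" by blast
  then have "?S \<noteq> {}" by blast
  from nonempty[OF this] Min_le[OF fin mem] show "zeta \<nu> i b \<le> b ! j" by argo
qed

text \<open>The new value is \<open>top_height \<nu>\<close> or a copy of an entry further left; in
  the latter case nesting to the right is inherited from that entry.\<close>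

lemma bracket_vector_zeta:
  assumes b: "bracket_vector \<nu> b" and i: "i \<le> length \<nu>" "i \<notin> fixed_positions \<nu>"
  shows "bracket_vector \<nu> (b[i := zeta \<nu> i b])"
proof (rule bracket_vector_update[OF b i])
  show "height \<nu> i \<le> zeta \<nu> i b"
    using zeta_props(1)[OF b i(1)] bracket_vectorD(2)[OF b i(1)] by simp
  show "zeta \<nu> i b \<le> top_height \<nu>" by (rule zeta_props(2)[OF b i(1)])
  show "b ! j \<le> zeta \<nu> i b" if j: "i < j" "j \<le> length \<nu>" "height \<nu> j \<le> zeta \<nu> i b" for j
    using zeta_props(3)[OF b i(1)]
  proof
    assume "zeta \<nu> i b = top_height \<nu>"
    then show ?thesis using bracket_vectorD(3)[OF b j(2)] by simp
  next
    assume "\<exists>k<i. zeta \<nu> i b = b ! k"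
    then obtain k where "k < i" "zeta \<nu> i b = b ! k" by blast
    then show ?thesis using bracket_vectorD(5)[OF b, of k j] j by simp
  qed
  show "zeta \<nu> i b \<le> b ! j" if "j < i" "height \<nu> i \<le> b ! j" for j
    using zeta_props(4)[OF b i(1) that(1)] bracket_vectorD(5)[OF b that(1) i(1) that(2)] by blast
qed

section \<open>Order and cover relations\<close>

lemma Tam_simps [simp]:
  "b \<in> carrier (Tam \<nu>) \<longleftrightarrow> bracket_vector \<nu> b"
  "x \<sqsubseteq>\<^bsub>Tam \<nu>\<^esub> y \<longleftrightarrow> list_all2 (\<le>) x y"
  "x \<sqsubset>\<^bsub>Tam \<nu>\<^esub> y \<longleftrightarrow> list_all2 (\<le>) x y \<and> x \<noteq> y"
  by (simp_all add: Tam_def lless_def)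

lemma Tam_le_iff:
  assumes "bracket_vector \<nu> x" "bracket_vector \<nu> y"
  shows "list_all2 (\<le>) x y \<longleftrightarrow> (\<forall>i\<le>length \<nu>. x ! i \<le> y ! i)"
  using bracket_vectorD(1)[OF assms(1)] bracket_vectorD(1)[OF assms(2)]
  by (auto simp: list_all2_conv_all_nth less_Suc_eq_le)

lemma bracket_vector_eqI:
  assumes "bracket_vector \<nu> x" "bracket_vector \<nu> y" "\<And>i. i \<le> length \<nu> \<Longrightarrow> x ! i = y ! i"
  shows "x = y"
  using assms(3) bracket_vectorD(1)[OF assms(1)] bracket_vectorD(1)[OF assms(2)]
  by (auto intro: nth_equalityI simp: less_Suc_eq_le)

lemma nth_eta_update:
  assumes b: "bracket_vector \<nu> b" and "i \<in> descents \<nu> b"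
  shows "b[i := eta \<nu> i b] ! j = (if j = i then eta \<nu> i b else b ! j)"
  using bracket_vectorD(1)[OF b] descents_not_fixed[OF assms] by (auto simp: nth_list_update)

text \<open>The last position where \<open>c\<close> and \<open>b\<close> differ is the descent whose lower cover lies above \<open>c\<close>.\<close>

lemma below_eta_update:
  assumes b: "bracket_vector \<nu> b" and c: "bracket_vector \<nu> c"
    and le: "list_all2 (\<le>) c b" and ne: "c \<noteq> b"
  obtains i where "i \<in> descents \<nu> b" "list_all2 (\<le>) c (b[i := eta \<nu> i b])"
proof -
  have le': "c ! i \<le> b ! i" if "i \<le> length \<nu>" for i
    using le that unfolding Tam_le_iff[OF c b] by blast
  let ?D = "{i. i \<le> length \<nu> \<and> c ! i \<noteq> b ! i}"
  have fin: "finite ?D" by simp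
  have "?D \<noteq> {}" using bracket_vector_eqI[OF c b] ne by blast
  define i where "i = Max ?D"
  have "i \<in> ?D" unfolding i_def by (rule Max_in) fact+
  then have i: "i \<le> length \<nu>" "c ! i < b ! i" using le'[of i] by auto
  have eq: "c ! j = b ! j" if "i < j" "j \<le> length \<nu>" for j
    using Max_ge[OF fin, of j] that unfolding i_def[symmetric] by auto
  have nf: "i \<notin> fixed_positions \<nu>"
    using i bracket_vectorD(4)[OF b] bracket_vectorD(4)[OF c] by fastforce
  note nf' = not_fixedD[OF i(1) nf]
  have desc: "i \<in> descents \<nu> b"
    using bracket_vector_nth_Suc_le[OF c i(1) nf] eq[of "Suc i"] i nf' by (simp add: descents_def)
  \<comment> \<open>To the right of \<open>i\<close> the vectors agree, so nesting in
    \<open>c\<close> makes \<open>c ! i\<close> one of the candidates whose maximum is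
    \<open>eta \<nu> i b\<close>.\<close>
  have "c ! i \<le> eta \<nu> i b"
  proof (rule eta_props(4)[OF b desc])
    show "height \<nu> i \<le> c ! i" by (rule bracket_vectorD(2)[OF c i(1)])
    show "c ! i < b ! i" by (rule i(2))
    show "b ! j \<le> c ! i" if "i < j" "j \<le> length \<nu>" "height \<nu> j \<le> c ! i" for j
      using bracket_vectorD(5)[OF c that] eq[OF that(1,2)] by simp
  qed
  then have "list_all2 (\<le>) c (b[i := eta \<nu> i b])"
    unfolding Tam_le_iff[OF c bracket_vector_eta[OF b desc]] nth_eta_update[OF b desc]
    using le' by simp
  with desc that show thesis by blast
qed

text \<open>Every vector strictly below \<open>b\<close> lies under some
  \<open>b[i := eta \<nu> i b]\<close>, so there are no other lower covers; and the vectors from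
  different descents are incomparable, so each of them is one.\<close>

lemma covered_by_Tam_iff:
  assumes b: "bracket_vector \<nu> b"
  shows "covered_by (Tam \<nu>) x b \<longleftrightarrow> (\<exists>i\<in>descents \<nu> b. x = b[i := eta \<nu> i b])"
proof -
  have lower: "bracket_vector \<nu> (b[i := eta \<nu> i b]) \<and> list_all2 (\<le>) (b[i := eta \<nu> i b]) b
      \<and> b[i := eta \<nu> i b] \<noteq> b" if i: "i \<in> descents \<nu> b" for i
  proof -
    note bv = bracket_vector_eta[OF b i] and nth = nth_eta_update[OF b i]
    have "list_all2 (\<le>) (b[i := eta \<nu> i b]) b"
      unfolding Tam_le_iff[OF bv b] nth using eta_props(2)[OF b i] by auto
    moreover have "b[i := eta \<nu> i b] ! i \<noteq> b ! i"
      unfolding nth using eta_props(2)[OF b i] by auto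
    ultimately show ?thesis using bv by metis
  qed
  show ?thesis
  proof
    assume cov: "covered_by (Tam \<nu>) x b"
    then have x: "bracket_vector \<nu> x" "list_all2 (\<le>) x b" "x \<noteq> b"
      by (auto simp: covered_by_def)
    obtain i where i: "i \<in> descents \<nu> b" "list_all2 (\<le>) x (b[i := eta \<nu> i b])"
      using below_eta_update[OF b x] by blast
    then show "\<exists>i\<in>descents \<nu> b. x = b[i := eta \<nu> i b]"
      using cov lower[OF i(1)] unfolding covered_by_def by (auto simp del: list_all2_update_cong)
  next
    assume "\<exists>i\<in>descents \<nu> b. x = b[i := eta \<nu> i b]"
    then obtain i where i: "i \<in> descents \<nu> b" and x: "x = b[i := eta \<nu> i b]" by blast
    note bvx = bracket_vector_eta[OF b i, folded x]
    note nthx = nth_eta_update[OF b i, folded x]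
    have "False" if z: "bracket_vector \<nu> z" "list_all2 (\<le>) x z" "x \<noteq> z"
      "list_all2 (\<le>) z b" "z \<noteq> b" for z
    proof -
      obtain k where k: "k \<in> descents \<nu> b" "list_all2 (\<le>) z (b[k := eta \<nu> k b])"
        using below_eta_update[OF b z(1,4,5)] by blast
      note bvk = bracket_vector_eta[OF b k(1)]
      have xz: "x ! j \<le> z ! j" and zk: "z ! j \<le> b[k := eta \<nu> k b] ! j" if "j \<le> length \<nu>" for j
        using z(2) k(2) that unfolding Tam_le_iff[OF bvx z(1)] Tam_le_iff[OF z(1) bvk] by auto
      have "k \<le> length \<nu>" using descents_not_fixed(1)[OF b k(1)] .
      \<comment> \<open>At \<open>k\<close> the vector \<open>x\<close> is at most
        \<open>eta \<nu> k b\<close>, hence smaller than \<open>b\<close>; but \<open>x\<close>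
        differs from \<open>b\<close> only at \<open>i\<close>.\<close>
      from xz[OF this] zk[OF this] have "k = i"
        unfolding nthx nth_eta_update[OF b k(1)] using eta_props(2)[OF b k(1)]
        by (auto split: if_splits)
      then have "x = z"
        using xz zk x by (intro bracket_vector_eqI[OF bvx z(1)]) (metis le_antisym)
      then show False using z(3) by simp
    qed
    then show "covered_by (Tam \<nu>) x b"
      using lower[OF i] b unfolding covered_by_def x[symmetric] by auto
  qed
qed

section \<open>Join-irreducible elements\<close>

text \<open>For non-fixed \<open>i\<close> and \<open>t\<close> between
  \<open>height \<nu> i\<close> and \<open>top_height \<nu>\<close>, this is the least bracket
  vector with entry at least \<open>t\<close> at \<open>i\<close>. Positions of the same height
  further left must carry \<open>t\<close> too, as nesting there covers \<open>i\<close>.\<close>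

definition join_irr :: "path \<Rightarrow> nat \<Rightarrow> nat \<Rightarrow> nat list" where
  "join_irr \<nu> i t =
     map (\<lambda>j. if j \<le> i \<and> height \<nu> j = height \<nu> i then t else height \<nu> j) [0..<length \<nu> + 1]"

text \<open>
  The greatest bracket vector whose entry at \<open>i\<close> equals \<open>s\<close>; some vectors with a smaller entry
  at \<open>i\<close> are not below it.
\<close>

definition meet_irr :: "path \<Rightarrow> nat \<Rightarrow> nat \<Rightarrow> nat list" where
  "meet_irr \<nu> i s =
     map (\<lambda>j. if j \<in> fixed_positions \<nu> then height \<nu> j
              else if i \<le> j \<and> height \<nu> j \<le> s then s else top_height \<nu>) [0..<length \<nu> + 1]"

lemma nth_join_irr:
  "j \<le> length \<nu> \<Longrightarrow>
     join_irr \<nu> i t ! j = (if j \<le> i \<and> height \<nu> j = height \<nu> i then t else height \<nu> j)"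
  unfolding join_irr_def by (subst nth_map) (auto simp del: upt_Suc simp: less_Suc_eq_le)

lemma nth_meet_irr:
  "j \<le> length \<nu> \<Longrightarrow>
     meet_irr \<nu> i s ! j = (if j \<in> fixed_positions \<nu> then height \<nu> j
       else if i \<le> j \<and> height \<nu> j \<le> s then s else top_height \<nu>)"
  unfolding meet_irr_def by (subst nth_map) (auto simp del: upt_Suc simp: less_Suc_eq_le)

lemma bracket_vector_join_irr:
  assumes i: "i \<le> length \<nu>" "i \<notin> fixed_positions \<nu>"
    and t: "height \<nu> i \<le> t" "t \<le> top_height \<nu>"
  shows "bracket_vector \<nu> (join_irr \<nu> i t)"
  unfolding bracket_vector_iff
proof (intro conjI allI impI)
  show "length (join_irr \<nu> i t) = length \<nu> + 1" by (simp add: join_irr_def)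
  fix j assume j: "j \<le> length \<nu>"
  show "height \<nu> j \<le> join_irr \<nu> i t ! j" "join_irr \<nu> i t ! j \<le> top_height \<nu>"
    using t height_mono[OF j] unfolding nth_join_irr[OF j] by auto
  show "join_irr \<nu> i t ! j = height \<nu> j" if "j \<in> fixed_positions \<nu>"
    using not_fixed_if_height_eq[of j i \<nu>] i that unfolding nth_join_irr[OF j]
    by (cases "j = i") auto
next
  fix j k assume jk: "j < k" "k \<le> length \<nu>" "height \<nu> k \<le> join_irr \<nu> i t ! j"
  have j: "j \<le> length \<nu>" using jk by simp
  show "join_irr \<nu> i t ! k \<le> join_irr \<nu> i t ! j"
    using jk(1,3) height_mono[of j k \<nu>] t height_mono[of k i \<nu>]
    unfolding nth_join_irr[OF j] nth_join_irr[OF jk(2)] by (auto split: if_splits)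
qed

lemma bracket_vector_meet_irr:
  assumes s: "height \<nu> i \<le> s" "s \<le> top_height \<nu>"
  shows "bracket_vector \<nu> (meet_irr \<nu> i s)"
  unfolding bracket_vector_iff
proof (intro conjI allI impI)
  show "length (meet_irr \<nu> i s) = length \<nu> + 1" by (simp add: meet_irr_def)
  fix j assume j: "j \<le> length \<nu>"
  show "height \<nu> j \<le> meet_irr \<nu> i s ! j" "meet_irr \<nu> i s ! j \<le> top_height \<nu>"
    using s height_mono[OF j] unfolding nth_meet_irr[OF j] by auto
  show "meet_irr \<nu> i s ! j = height \<nu> j" if "j \<in> fixed_positions \<nu>"
    using that unfolding nth_meet_irr[OF j] by simp
next
  fix j k assume jk: "j < k" "k \<le> length \<nu>" "height \<nu> k \<le> meet_irr \<nu> i s ! j"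
  have j: "j \<le> length \<nu>" using jk by simp
  \<comment> \<open>A fixed position has smaller height than every later one, so its nesting
    condition is vacuous.\<close>
  have "height \<nu> j < height \<nu> k" if "j \<in> fixed_positions \<nu>"
    using not_fixed_if_height_eq[OF jk(1,2)] that height_mono[of j k \<nu>] jk(1) by fastforce
  then show "meet_irr \<nu> i s ! k \<le> meet_irr \<nu> i s ! j"
    using jk height_mono[of j k \<nu>] s height_mono[OF jk(2)]
    unfolding nth_meet_irr[OF j] nth_meet_irr[OF jk(2)] by (auto split: if_splits)
qed

lemma join_irr_le_iff:
  assumes b: "bracket_vector \<nu> b" and i: "i \<le> length \<nu>" "i \<notin> fixed_positions \<nu>"
    and t: "height \<nu> i \<le> t" "t \<le> top_height \<nu>"
  shows "list_all2 (\<le>) (join_irr \<nu> i t) b \<longleftrightarrow> t \<le> b ! i"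
proof
  assume "list_all2 (\<le>) (join_irr \<nu> i t) b"
  then show "t \<le> b ! i"
    unfolding Tam_le_iff[OF bracket_vector_join_irr[OF assms(2-)] b]
    using i(1) nth_join_irr[OF i(1)] by (metis order_refl)
next
  assume t: "t \<le> b ! i"
  have "t \<le> b ! j" if "j \<le> i" "height \<nu> j = height \<nu> i" for j
  proof (cases "j = i")
    case False
    then have "b ! i \<le> b ! j"
      using that bracket_vectorD(5)[OF b, of j i] bracket_vectorD(2)[OF b, of j] i(1) by simp
    then show ?thesis using t by simp
  qed (use t in simp)
  then show "list_all2 (\<le>) (join_irr \<nu> i t) b"
    unfolding Tam_le_iff[OF bracket_vector_join_irr[OF assms(2-)] b]
    using bracket_vectorD(2)[OF b] by (simp add: nth_join_irr)
qed

text \<open>At fixed positions the comparison holds in any case, and \<open>top_height \<nu>\<close>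
  is no constraint, so only the value \<open>s\<close> counts. The condition to the right is the one
  that candidates for \<open>eta\<close> satisfy.\<close>

lemma le_meet_irr_iff:
  assumes b: "bracket_vector \<nu> b" and i: "i \<le> length \<nu>" "i \<notin> fixed_positions \<nu>"
    and s: "height \<nu> i \<le> s" "s \<le> top_height \<nu>"
  shows "list_all2 (\<le>) b (meet_irr \<nu> i s) \<longleftrightarrow>
     b ! i \<le> s \<and> (\<forall>j. i < j \<longrightarrow> j \<le> length \<nu> \<longrightarrow> height \<nu> j \<le> s \<longrightarrow> b ! j \<le> s)"
proof -
  have "b ! j \<le> meet_irr \<nu> i s ! j \<longleftrightarrow> (i \<le> j \<and> height \<nu> j \<le> s \<longrightarrow> b ! j \<le> s)"
    if j: "j \<le> length \<nu>" for j
    using bracket_vectorD(3,4)[OF b j] j by (auto simp: nth_meet_irr)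
  then show ?thesis
    unfolding Tam_le_iff[OF b bracket_vector_meet_irr[OF s]]
    using i s by (metis le_less order_refl)
qed

text \<open>Entries equal the heights except on the run up to \<open>i\<close>, where they are
  \<open>Suc s\<close>. As \<open>i\<close> is not fixed, the height stays the same just after
  \<open>i\<close>, and the only drop occurs there.\<close>

lemma descents_join_irr:
  assumes i: "i \<le> length \<nu>" "i \<notin> fixed_positions \<nu>"
    and s: "height \<nu> i \<le> s" "s < top_height \<nu>"
  shows "descents \<nu> (join_irr \<nu> i (Suc s)) = {i}"
proof -
  have "k = i" if k: "k < length \<nu>" "join_irr \<nu> i (Suc s) ! Suc k < join_irr \<nu> i (Suc s) ! k" for k
    using k height_mono[of k "Suc k" \<nu>] height_mono[of "Suc k" i \<nu>] s
    by (simp add: nth_join_irr split: if_splits)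
  moreover have "i \<in> descents \<nu> (join_irr \<nu> i (Suc s))"
    using not_fixedD[OF i] s by (simp add: descents_def nth_join_irr)
  ultimately show ?thesis by (auto simp: descents_def)
qed

lemma eta_join_irr:
  assumes i: "i \<le> length \<nu>" "i \<notin> fixed_positions \<nu>"
    and s: "height \<nu> i \<le> s" "s < top_height \<nu>"
  shows "eta \<nu> i (join_irr \<nu> i (Suc s)) = s"
proof -
  have bv: "bracket_vector \<nu> (join_irr \<nu> i (Suc s))"
    using bracket_vector_join_irr[OF i] s by simp
  have desc: "i \<in> descents \<nu> (join_irr \<nu> i (Suc s))"
    using descents_join_irr[OF assms] by simp
  have nth: "join_irr \<nu> i (Suc s) ! i = Suc s" using nth_join_irr[OF i(1)] by simp
  have "s \<le> eta \<nu> i (join_irr \<nu> i (Suc s))"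
    by (rule eta_props(4)[OF bv desc s(1)]) (simp_all add: nth nth_join_irr)
  then show ?thesis using eta_props(2)[OF bv desc] nth by simp
qed

lemma covered_by_join_irr_iff:
  assumes "i \<le> length \<nu>" "i \<notin> fixed_positions \<nu>" "height \<nu> i \<le> s" "s < top_height \<nu>"
  shows "covered_by (Tam \<nu>) x (join_irr \<nu> i (Suc s)) \<longleftrightarrow> x = (join_irr \<nu> i (Suc s))[i := s]"
  using covered_by_Tam_iff[of \<nu> "join_irr \<nu> i (Suc s)" x] bracket_vector_join_irr[of i \<nu> "Suc s"] assms
  by (simp add: descents_join_irr eta_join_irr)

text \<open>With a single lower cover, obtained at a descent \<open>i\<close>, everything strictly
  below \<open>j\<close> has an entry smaller than \<open>j ! i\<close> at \<open>i\<close>; so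
  \<open>join_irr \<nu> i (j ! i)\<close>, which lies below \<open>j\<close>, must be
  \<open>j\<close>.\<close>

lemma join_irreducible_iff:
  "join_irreducible (Tam \<nu>) j \<longleftrightarrow>
     (\<exists>i s. i \<le> length \<nu> \<and> i \<notin> fixed_positions \<nu> \<and> height \<nu> i \<le> s \<and> s < top_height \<nu> \<and>
        j = join_irr \<nu> i (Suc s))"
proof
  assume "join_irreducible (Tam \<nu>) j"
  then have j: "bracket_vector \<nu> j" and ex1: "\<exists>!x. covered_by (Tam \<nu>) x j"
    by (auto simp: join_irreducible_def)
  from ex1 obtain i where i: "i \<in> descents \<nu> j"
    unfolding covered_by_Tam_iff[OF j] by blast
  note nf = descents_not_fixed[OF j i] and eta = eta_props(1,2)[OF j i]
  have ht: "height \<nu> i \<le> j ! i" "j ! i \<le> top_height \<nu>"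
    using bracket_vectorD[OF j] nf by blast+
  note bv = bracket_vector_join_irr[OF nf ht]
  have "join_irr \<nu> i (j ! i) = j"
  proof (rule ccontr)
    assume ne: "join_irr \<nu> i (j ! i) \<noteq> j"
    have "list_all2 (\<le>) (join_irr \<nu> i (j ! i)) j"
      using join_irr_le_iff[OF j nf ht] by simp
    then obtain k where k: "k \<in> descents \<nu> j"
      and le: "list_all2 (\<le>) (join_irr \<nu> i (j ! i)) (j[k := eta \<nu> k j])"
      using below_eta_update[OF j bv _ ne] by blast
    have "j[k := eta \<nu> k j] = j[i := eta \<nu> i j]"
      using ex1 i k unfolding covered_by_Tam_iff[OF j] by blast
    then have "j ! i \<le> j[i := eta \<nu> i j] ! i"
      using le join_irr_le_iff[OF bracket_vector_eta[OF j k] nf ht] by simp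
    then show False using eta by (simp add: nth_eta_update[OF j i])
  qed
  moreover obtain s where "j ! i = Suc s" using eta by (cases "j ! i") auto
  ultimately show "\<exists>i s. i \<le> length \<nu> \<and> i \<notin> fixed_positions \<nu> \<and> height \<nu> i \<le> s \<and> s < top_height \<nu> \<and>
      j = join_irr \<nu> i (Suc s)"
    using nf eta ht by (intro exI[of _ i] exI[of _ s]) simp
next
  assume "\<exists>i s. i \<le> length \<nu> \<and> i \<notin> fixed_positions \<nu> \<and> height \<nu> i \<le> s \<and> s < top_height \<nu> \<and>
      j = join_irr \<nu> i (Suc s)"
  then obtain i s where i: "i \<le> length \<nu>" "i \<notin> fixed_positions \<nu>"
    and s: "height \<nu> i \<le> s" "s < top_height \<nu>" and j: "j = join_irr \<nu> i (Suc s)" by blast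
  then show "join_irreducible (Tam \<nu>) j"
    using covered_by_join_irr_iff[OF i s] bracket_vector_join_irr[OF i, of "Suc s"]
    by (simp add: join_irreducible_def)
qed

text \<open>Both parameters can be read off the vector: \<open>i\<close> as its only descent and
  \<open>s\<close> as the value of \<open>eta\<close> there.\<close>

lemma join_irr_inject:
  assumes i: "i \<le> length \<nu>" "i \<notin> fixed_positions \<nu>" "height \<nu> i \<le> s" "s < top_height \<nu>"
    and i': "i' \<le> length \<nu>" "i' \<notin> fixed_positions \<nu>" "height \<nu> i' \<le> s'" "s' < top_height \<nu>"
    and eq: "join_irr \<nu> i (Suc s) = join_irr \<nu> i' (Suc s')"
  shows "i = i' \<and> s = s'"
proof -
  have "{i} = {i'}"
    by (rule trans[OF descents_join_irr[OF i, symmetric] descents_join_irr[OF i', folded eq]])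
  then have ii: "i = i'" by blast
  have "s = s'"
    by (rule trans[OF eta_join_irr[OF i, symmetric] eta_join_irr[OF i', folded eq ii]])
  with ii show ?thesis by blast
qed

section \<open>Meets and the map kappa\<close>

lemma bracket_vector_min:
  assumes x: "bracket_vector \<nu> x" and y: "bracket_vector \<nu> y"
  shows "bracket_vector \<nu> (map2 min x y)"
    and "\<And>i. i \<le> length \<nu> \<Longrightarrow> map2 min x y ! i = min (x ! i) (y ! i)"
proof -
  show nth: "map2 min x y ! i = min (x ! i) (y ! i)" if "i \<le> length \<nu>" for i
    using that bracket_vectorD(1)[OF x] bracket_vectorD(1)[OF y] by simp
  show "bracket_vector \<nu> (map2 min x y)"
    unfolding bracket_vector_iff
  proof (intro conjI allI impI)
    show "length (map2 min x y) = length \<nu> + 1"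
      using bracket_vectorD(1)[OF x] bracket_vectorD(1)[OF y] by simp
    fix i assume i: "i \<le> length \<nu>"
    show "height \<nu> i \<le> map2 min x y ! i" "map2 min x y ! i \<le> top_height \<nu>"
      "i \<in> fixed_positions \<nu> \<Longrightarrow> map2 min x y ! i = height \<nu> i"
      unfolding nth[OF i] using bracket_vectorD(2-4)[OF x i] bracket_vectorD(2-4)[OF y i] by auto
  next
    fix i j assume ij: "i < j" "j \<le> length \<nu>" "height \<nu> j \<le> map2 min x y ! i"
    have i: "i \<le> length \<nu>" using ij by simp
    show "map2 min x y ! j \<le> map2 min x y ! i"
    proof (cases "x ! i \<le> y ! i")
      case True
      then have "x ! j \<le> x ! i"
        using ij(3) bracket_vectorD(5)[OF x ij(1,2)] unfolding nth[OF i] by simp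
      then show ?thesis
        using True unfolding nth[OF i] nth[OF ij(2)] by (simp add: min.coboundedI1)
    next
      case False
      then have "y ! j \<le> y ! i"
        using ij(3) bracket_vectorD(5)[OF y ij(1,2)] unfolding nth[OF i] by simp
      then show ?thesis
        using False unfolding nth[OF i] nth[OF ij(2)] by (simp add: min.coboundedI2)
    qed
  qed
qed

text \<open>\<open>meet\<close> picks some greatest lower bound, so evaluating it takes uniqueness
  as well as existence.\<close>

lemma meet_Tam:
  assumes x: "bracket_vector \<nu> x" and y: "bracket_vector \<nu> y"
  shows "x \<sqinter>\<^bsub>Tam \<nu>\<^esub> y = map2 min x y"
proof -
  note m = bracket_vector_min[OF x y]
  have lower: "z \<in> Lower (Tam \<nu>) {x, y} \<longleftrightarrow>
      bracket_vector \<nu> z \<and> list_all2 (\<le>) z (map2 min x y)" for z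
    using x y m by (auto simp: Lower_def Tam_le_iff)
  have "greatest (Tam \<nu>) g (Lower (Tam \<nu>) {x, y}) \<longleftrightarrow> g = map2 min x y" for g
  proof
    assume g: "greatest (Tam \<nu>) g (Lower (Tam \<nu>) {x, y})"
    then have bg: "bracket_vector \<nu> g" and le: "list_all2 (\<le>) g (map2 min x y)"
      and ge: "list_all2 (\<le>) (map2 min x y) g"
      using m(1) unfolding greatest_def lower
      by (auto simp: lower Tam_le_iff[OF m(1) m(1)])
    show "g = map2 min x y"
      using le ge unfolding Tam_le_iff[OF bg m(1)] Tam_le_iff[OF m(1) bg]
      by (intro bracket_vector_eqI[OF bg m(1)] le_antisym) auto
  next
    assume "g = map2 min x y"
    then show "greatest (Tam \<nu>) g (Lower (Tam \<nu>) {x, y})"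
      using m(1) unfolding greatest_def
      by (auto simp: lower Tam_le_iff[OF m(1) m(1)] Lower_closed)
  qed
  then show ?thesis
    unfolding meet_def inf_def by simp
qed

text \<open>Since \<open>join_irr\<close> has entry \<open>Suc s\<close> at \<open>i\<close>, a meet
  equal to its lower cover forces the other vector to have entry exactly \<open>s\<close> there;
  \<open>meet_irr\<close> is the greatest such vector.\<close>

lemma kappa_join_irr:
  assumes i: "i \<le> length \<nu>" "i \<notin> fixed_positions \<nu>"
    and s: "height \<nu> i \<le> s" "s < top_height \<nu>"
  shows "kappa (Tam \<nu>) (join_irr \<nu> i (Suc s)) = meet_irr \<nu> i s"
proof -
  let ?j = "join_irr \<nu> i (Suc s)" and ?m = "meet_irr \<nu> i s"
  have j: "bracket_vector \<nu> ?j" using bracket_vector_join_irr[OF i] s by simp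
  have m: "bracket_vector \<nu> ?m" using bracket_vector_meet_irr s by simp
  have star: "lower_star (Tam \<nu>) ?j = ?j[i := s]"
    unfolding lower_star_def covered_by_join_irr_iff[OF i s] by simp
  have star_bv: "bracket_vector \<nu> (?j[i := s])"
    using bracket_vector_eta[OF j, of i] descents_join_irr[OF i s] eta_join_irr[OF i s] by simp
  have star_nth: "?j[i := s] ! k = (if k = i then s else ?j ! k)" if "k \<le> length \<nu>" for k
    using that bracket_vectorD(1)[OF j] i by (simp add: nth_list_update)
  define S where "S = {z \<in> carrier (Tam \<nu>). z \<sqinter>\<^bsub>Tam \<nu>\<^esub> ?j = lower_star (Tam \<nu>) ?j}"
  have S: "z \<in> S \<longleftrightarrow> bracket_vector \<nu> z \<and>
      (\<forall>k\<le>length \<nu>. min (z ! k) (?j ! k) = (if k = i then s else ?j ! k))" for z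
  proof (cases "bracket_vector \<nu> z")
    case True
    note mn = bracket_vector_min[OF True j]
    have "map2 min z ?j = ?j[i := s] \<longleftrightarrow>
        (\<forall>k\<le>length \<nu>. min (z ! k) (?j ! k) = (if k = i then s else ?j ! k))"
      using bracket_vector_eqI[OF mn(1) star_bv] mn(2) star_nth by metis
    then show ?thesis
      using True by (simp add: S_def star meet_Tam[OF True j])
  qed (simp add: S_def)
  have ji: "?j ! i = Suc s" using nth_join_irr[OF i(1)] by simp
  have "?m \<in> S"
  proof -
    have "?m ! i = s" using i s by (simp add: nth_meet_irr)
    \<comment> \<open>Away from \<open>i\<close>, an entry of \<open>?j\<close> can exceed the
      height only on the run before \<open>i\<close>, where \<open>?m\<close> takes the value
      \<open>top_height \<nu>\<close>.\<close>
    moreover have "?j ! k \<le> ?m ! k" if k: "k \<le> length \<nu>" "k \<noteq> i" for k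
      using bracket_vectorD(2)[OF m k(1)] not_fixed_if_height_eq[of k i \<nu>] k i s
      by (auto simp: nth_join_irr nth_meet_irr)
    ultimately show ?thesis unfolding S using m ji by (simp add: min.absorb2)
  qed
  moreover have below: "list_all2 (\<le>) z ?m" if "z \<in> S" for z
  proof -
    from that have z: "bracket_vector \<nu> z" and "min (z ! i) (?j ! i) = s"
      using i(1) unfolding S by auto
    then have zi: "z ! i = s" unfolding ji by (simp add: min_def split: if_splits)
    show ?thesis
      unfolding le_meet_irr_iff[OF z i s(1) less_imp_le[OF s(2)]]
      using zi bracket_vectorD(5)[OF z, of i] by auto
  qed
  ultimately have gm: "greatest (Tam \<nu>) ?m S"
    unfolding greatest_def by (auto simp: S_def)
  have "g = ?m" if "greatest (Tam \<nu>) g S" for g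
  proof -
    have g: "g \<in> S" "bracket_vector \<nu> g" and ge: "list_all2 (\<le>) ?m g"
      using that \<open>?m \<in> S\<close> S unfolding greatest_def by auto
    show ?thesis
      using ge below[OF g(1)] unfolding Tam_le_iff[OF g(2) m] Tam_le_iff[OF m g(2)]
      by (intro bracket_vector_eqI[OF g(2) m] le_antisym) auto
  qed
  with gm show ?thesis
    unfolding kappa_def S_def[symmetric] by (intro the_equality)
qed

section \<open>Edge labels and down-labels\<close>

text \<open>For a candidate with parameters \<open>k\<close> and \<open>s\<close>, being below
  \<open>b\<close> gives \<open>Suc s \<le> b ! k\<close>, and the condition on \<open>kappa\<close>
  gives the lower vector an entry at most \<open>s\<close> at \<open>k\<close>. The two vectors thus
  differ at \<open>k\<close>, so \<open>k = i\<close>; that entry is \<open>eta \<nu> i b\<close>,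
  and the maximality of \<open>eta\<close> gives the reverse inequality.\<close>

lemma edge_label_eta:
  assumes b: "bracket_vector \<nu> b" and i: "i \<in> descents \<nu> b"
  shows "edge_label (Tam \<nu>) (b[i := eta \<nu> i b]) b = join_irr \<nu> i (Suc (eta \<nu> i b))"
proof -
  let ?e = "eta \<nu> i b" let ?x = "b[i := ?e]"
  note nf = descents_not_fixed[OF b i]
  note x = bracket_vector_eta[OF b i] and nth = nth_eta_update[OF b i]
  have e: "height \<nu> i \<le> ?e" "?e < b ! i" by (rule eta_props[OF b i])+
  then have et: "?e < top_height \<nu>" using bracket_vectorD(3)[OF b nf(1)] by simp
  show ?thesis
    unfolding edge_label_def Tam_simps
  proof (rule the_equality)
    show "join_irreducible (Tam \<nu>) (join_irr \<nu> i (Suc ?e)) \<and>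
        list_all2 (\<le>) (join_irr \<nu> i (Suc ?e)) b \<and>
        list_all2 (\<le>) ?x (kappa (Tam \<nu>) (join_irr \<nu> i (Suc ?e)))"
    proof (intro conjI)
      show "join_irreducible (Tam \<nu>) (join_irr \<nu> i (Suc ?e))"
        unfolding join_irreducible_iff using nf e et by blast
      show "list_all2 (\<le>) (join_irr \<nu> i (Suc ?e)) b"
        using join_irr_le_iff[OF b nf, of "Suc ?e"] e et by simp
      show "list_all2 (\<le>) ?x (kappa (Tam \<nu>) (join_irr \<nu> i (Suc ?e)))"
        unfolding kappa_join_irr[OF nf e(1) et] le_meet_irr_iff[OF x nf e(1) less_imp_le[OF et]] nth
        using eta_props(3)[OF b i] by simp
    qed
    fix j assume j: "join_irreducible (Tam \<nu>) j \<and> list_all2 (\<le>) j b \<and>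
        list_all2 (\<le>) ?x (kappa (Tam \<nu>) j)"
    then obtain k s where k: "k \<le> length \<nu>" "k \<notin> fixed_positions \<nu>"
      and s: "height \<nu> k \<le> s" "s < top_height \<nu>" and jeq: "j = join_irr \<nu> k (Suc s)"
      unfolding join_irreducible_iff by blast
    have "Suc s \<le> b ! k"
      using j join_irr_le_iff[OF b k, of "Suc s"] s unfolding jeq by simp
    moreover have le: "?x ! k \<le> s"
      "\<And>m. k < m \<Longrightarrow> m \<le> length \<nu> \<Longrightarrow> height \<nu> m \<le> s \<Longrightarrow> ?x ! m \<le> s"
      using j unfolding jeq kappa_join_irr[OF k s] le_meet_irr_iff[OF x k s(1) less_imp_le[OF s(2)]]
      by blast+
    ultimately have ki: "k = i" unfolding nth by (auto split: if_splits)
    have "s \<le> ?e"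
      using \<open>Suc s \<le> b ! k\<close> s(1) le(2) unfolding ki nth
      by (intro eta_props(4)[OF b i]) (auto split: if_splits)
    then show "j = join_irr \<nu> i (Suc ?e)"
      using le(1) unfolding jeq ki nth by simp
  qed
qed

lemma down_labels_Tam:
  assumes "bracket_vector \<nu> b"
  shows "down_labels (Tam \<nu>) b = (\<lambda>i. join_irr \<nu> i (Suc (eta \<nu> i b))) ` descents \<nu> b"
proof -
  have "down_labels (Tam \<nu>) b = (\<lambda>i. edge_label (Tam \<nu>) (b[i := eta \<nu> i b]) b) ` descents \<nu> b"
    unfolding down_labels_def covered_by_Tam_iff[OF assms] by blast
  then show ?thesis
    using edge_label_eta[OF assms] by simp
qed

section \<open>Upper covers and up-labels\<close>

text \<open>In a bracket vector, these are the positions whose entry some upper cover raises. An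
  equal entry further left would bar this, since its nesting bounds the entry at
  \<open>i\<close>.\<close>

definition raisable :: "path \<Rightarrow> nat list \<Rightarrow> nat set" where
  "raisable \<nu> b = {i. i \<le> length \<nu> \<and> i \<notin> fixed_positions \<nu> \<and> b ! i < top_height \<nu> \<and>
     (\<forall>j<i. b ! j \<noteq> b ! i)}"

lemma raisable_cover:
  assumes b: "bracket_vector \<nu> b" and i: "i \<in> raisable \<nu> b"
  obtains y where "bracket_vector \<nu> y" "i \<in> descents \<nu> y" "y[i := eta \<nu> i y] = b"
proof -
  from i have nf: "i \<le> length \<nu>" "i \<notin> fixed_positions \<nu>" and lt: "b ! i < top_height \<nu>"
    and ne: "\<And>j. j < i \<Longrightarrow> b ! j \<noteq> b ! i"
    by (auto simp: raisable_def)
  let ?P = "\<lambda>s. b ! i < s \<and> bracket_vector \<nu> (b[i := s])"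
  \<comment> \<open>\<open>zeta\<close> is \<open>top_height \<nu>\<close> or an entry further left,
    and raisability makes both differ from \<open>b ! i\<close>; so a proper raise exists.\<close>
  have "b ! i < zeta \<nu> i b"
    using zeta_props(1,3)[OF b nf(1)] lt ne by (metis le_neq_implies_less nat_neq_iff)
  then have ex: "?P (zeta \<nu> i b)" using bracket_vector_zeta[OF b nf] by blast
  \<comment> \<open>The least admissible raise is taken, as its minimality turns the step into a
    cover.\<close>
  define s where "s = (LEAST s. ?P s)"
  have s: "b ! i < s" and y: "bracket_vector \<nu> (b[i := s])"
    unfolding s_def using LeastI[of ?P, OF ex] by blast+
  have least: "s \<le> t" if "b ! i < t" "bracket_vector \<nu> (b[i := t])" for t
    unfolding s_def using that by (intro Least_le) blast
  let ?y = "b[i := s]"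
  have nth: "?y ! j = (if j = i then s else b ! j)" if "j \<le> length \<nu>" for j
    using bracket_vectorD(1)[OF b] nf that by (simp add: nth_list_update)
  have d: "i \<in> descents \<nu> ?y"
    using not_fixedD[OF nf] bracket_vector_nth_Suc_le[OF b nf] s by (simp add: descents_def nth)
  have "b ! i \<le> eta \<nu> i ?y"
  proof (rule eta_props(4)[OF y d])
    show "height \<nu> i \<le> b ! i" by (rule bracket_vectorD(2)[OF b nf(1)])
    show "b ! i < ?y ! i" using s nth[OF nf(1)] by simp
    show "?y ! j \<le> b ! i" if "i < j" "j \<le> length \<nu>" "height \<nu> j \<le> b ! i" for j
      using bracket_vectorD(5)[OF b that] that by (simp add: nth)
  qed
  \<comment> \<open>A value of \<open>eta\<close> above \<open>b ! i\<close> would itself be a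
    smaller admissible raise.\<close>
  moreover have "\<not> b ! i < eta \<nu> i ?y"
    using least[of "eta \<nu> i ?y"] bracket_vector_eta[OF y d] eta_props(2)[OF y d] nth[OF nf(1)] by auto
  ultimately have "eta \<nu> i ?y = b ! i" by simp
  then have "?y[i := eta \<nu> i ?y] = b" by simp
  with y d that show thesis by blast
qed

text \<open>An entry \<open>eta \<nu> i b\<close> further left would, by nesting in
  \<open>b\<close>, bound \<open>b ! i\<close> by that value, although \<open>b ! i\<close> is
  strictly larger.\<close>

lemma raisable_eta:
  assumes b: "bracket_vector \<nu> b" and i: "i \<in> descents \<nu> b"
  shows "i \<in> raisable \<nu> (b[i := eta \<nu> i b])"
proof -
  note nf = descents_not_fixed[OF b i] and nth = nth_eta_update[OF b i] and eta = eta_props(1,2)[OF b i]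
  have "b ! j \<noteq> eta \<nu> i b" if "j < i" for j
    using bracket_vectorD(5)[OF b that nf(1)] eta by auto
  then show ?thesis
    using nf eta bracket_vectorD(3)[OF b nf(1)] unfolding raisable_def nth by auto
qed

lemma up_labels_Tam:
  assumes b: "bracket_vector \<nu> b"
  shows "up_labels (Tam \<nu>) b = (\<lambda>i. join_irr \<nu> i (Suc (b ! i))) ` raisable \<nu> b"
proof (intro equalityI subsetI)
  fix j assume "j \<in> up_labels (Tam \<nu>) b"
  then obtain y where cov: "covered_by (Tam \<nu>) b y" and j: "j = edge_label (Tam \<nu>) b y"
    by (auto simp: up_labels_def)
  from cov have y: "bracket_vector \<nu> y" by (simp add: covered_by_def)
  obtain i where i: "i \<in> descents \<nu> y" and beq: "b = y[i := eta \<nu> i y]"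
    using cov unfolding covered_by_Tam_iff[OF y] by blast
  have "j = join_irr \<nu> i (Suc (b ! i))"
    unfolding j beq edge_label_eta[OF y i] nth_eta_update[OF y i] by simp
  moreover have "i \<in> raisable \<nu> b" unfolding beq by (rule raisable_eta[OF y i])
  ultimately show "j \<in> (\<lambda>i. join_irr \<nu> i (Suc (b ! i))) ` raisable \<nu> b" by blast
next
  fix j assume "j \<in> (\<lambda>i. join_irr \<nu> i (Suc (b ! i))) ` raisable \<nu> b"
  then obtain i where i: "i \<in> raisable \<nu> b" and j: "j = join_irr \<nu> i (Suc (b ! i))" by blast
  obtain y where y: "bracket_vector \<nu> y" and d: "i \<in> descents \<nu> y" and beq: "y[i := eta \<nu> i y] = b"
    using raisable_cover[OF b i] .
  have "b ! i = eta \<nu> i y" using nth_eta_update[OF y d, of i] beq by simp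
  then have "j = edge_label (Tam \<nu>) b y" using edge_label_eta[OF y d] beq j by simp
  moreover have "covered_by (Tam \<nu>) b y"
    unfolding covered_by_Tam_iff[OF y] using d beq by blast
  ultimately show "j \<in> up_labels (Tam \<nu>) b" by (auto simp: up_labels_def)
qed

text \<open>The vector is rebuilt from the left: labels give the entries at raisable positions, and
  any other entry is fixed by \<nu>, is \<open>top_height \<nu>\<close>, or repeats an earlier
  one.\<close>

lemma up_labels_inject:
  assumes x: "bracket_vector \<nu> x" and y: "bracket_vector \<nu> y"
    and eq: "up_labels (Tam \<nu>) x = up_labels (Tam \<nu>) y"
  shows "x = y"
proof -
  have sub: "i \<in> raisable \<nu> y \<and> x ! i = y ! i"
    if x: "bracket_vector \<nu> x" and y: "bracket_vector \<nu> y"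
      and eq: "up_labels (Tam \<nu>) x = up_labels (Tam \<nu>) y" and i: "i \<in> raisable \<nu> x" for x y i
  proof -
    have "join_irr \<nu> i (Suc (x ! i)) \<in> up_labels (Tam \<nu>) y"
      using i unfolding eq[symmetric] up_labels_Tam[OF x] by blast
    then obtain k where k: "k \<in> raisable \<nu> y" "join_irr \<nu> i (Suc (x ! i)) = join_irr \<nu> k (Suc (y ! k))"
      unfolding up_labels_Tam[OF y] by blast
    then have "i = k \<and> x ! i = y ! k"
      using i bracket_vectorD(2)[OF x, of i] bracket_vectorD(2)[OF y, of k]
      by (intro join_irr_inject[of i \<nu> "x ! i" k "y ! k"]) (auto simp: raisable_def)
    then show ?thesis using k(1) by metis
  qed
  have step: "x ! i \<le> y ! i"
    if x: "bracket_vector \<nu> x" and y: "bracket_vector \<nu> y"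
      and eq: "up_labels (Tam \<nu>) x = up_labels (Tam \<nu>) y"
      and i: "i \<le> length \<nu>" and prev: "\<And>j. j < i \<Longrightarrow> x ! j = y ! j" for x y i
  proof -
    have "i \<in> fixed_positions \<nu> \<or> i \<in> raisable \<nu> y \<or> y ! i = top_height \<nu> \<or> (\<exists>j<i. y ! j = y ! i)"
      using i bracket_vectorD(3)[OF y i] by (auto simp: raisable_def)
    then consider "i \<in> fixed_positions \<nu>" | "i \<in> raisable \<nu> y" | "y ! i = top_height \<nu>"
      | j where "j < i" "y ! j = y ! i" by blast
    then show ?thesis
    proof cases
      case 1
      then show ?thesis using bracket_vectorD(4)[OF x i] bracket_vectorD(4)[OF y i] by simp
    next
      case 2
      then show ?thesis using sub[OF y x eq[symmetric]] by simp
    next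
      case 3
      then show ?thesis using bracket_vectorD(3)[OF x i] by simp
    next
      \<comment> \<open>The repeated value is at least \<open>height \<nu> i\<close> and occurs at
        \<open>j\<close> in \<open>x\<close> too, so nesting in \<open>x\<close> gives the
        bound.\<close>
      case 4
      then show ?thesis
        using bracket_vectorD(5)[OF x 4(1) i] bracket_vectorD(2)[OF y i] prev by simp
    qed
  qed
  have "i \<le> length \<nu> \<longrightarrow> x ! i = y ! i" for i
  proof (induction i rule: less_induct)
    case (less i)
    show ?case
    proof
      assume i: "i \<le> length \<nu>"
      have "x ! j = y ! j" if "j < i" for j using less that i by simp
      then show "x ! i = y ! i"
        using step[OF x y eq i] step[OF y x eq[symmetric] i] by (simp add: le_antisym)
    qed
  qed
  then show ?thesis using bracket_vector_eqI[OF x y] by blast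
qed

section \<open>The composition of the maps Theta\<close>

text \<open>\<open>eta\<close> reads entries only from \<open>i\<close> rightwards, which the maps
  applied before position \<open>i\<close> leave unchanged.\<close>

lemma eta_cong:
  assumes "\<And>j. i \<le> j \<Longrightarrow> j \<le> length \<nu> \<Longrightarrow> c ! j = b ! j" "i \<le> length \<nu>" "b ! i \<le> top_height \<nu>"
  shows "eta \<nu> i c = eta \<nu> i b"
proof -
  have "c ! j = b ! j" if "h \<in> {height \<nu> i..<b ! i}" "j \<in> {i + 1..fixed_position \<nu> h}" for h j
    using assms that fixed_position_props(1)[of h \<nu>] by simp
  then have "{h \<in> {height \<nu> i..<c ! i}. \<forall>j\<in>{i + 1..fixed_position \<nu> h}. c ! j \<le> h} =
      {h \<in> {height \<nu> i..<b ! i}. \<forall>j\<in>{i + 1..fixed_position \<nu> h}. b ! j \<le> h}"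
    using assms(1)[OF order_refl assms(2)] by (intro Collect_cong) auto
  then show ?thesis by (simp only: eta_def)
qed

text \<open>After \<open>r\<close> maps, the entries from \<open>r\<close> on are those of
  \<open>b\<close>, and those before \<open>r\<close> are final. For the latter the invariant
  records what decides raisability: at descents of \<open>b\<close> a value not seen further left,
  at other non-fixed positions \<open>top_height \<nu>\<close> or a repetition.\<close>

lemma fold_Theta_invariant:
  assumes b: "bracket_vector \<nu> b" and r: "r \<le> length \<nu> + 1"
  defines "c \<equiv> \<lambda>r. fold (Theta \<nu>) [0..<r] b"
  shows "bracket_vector \<nu> (c r) \<and> (\<forall>j\<le>length \<nu>. r \<le> j \<longrightarrow> c r ! j = b ! j) \<and>
    (\<forall>j<r. (j \<in> descents \<nu> b \<longrightarrow> c r ! j = eta \<nu> j b \<and> (\<forall>i<j. c r ! i \<noteq> c r ! j)) \<and>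
      (j \<notin> descents \<nu> b \<longrightarrow> j \<notin> fixed_positions \<nu> \<longrightarrow>
        c r ! j = top_height \<nu> \<or> (\<exists>i<j. c r ! i = c r ! j)))"
  using r
proof (induction r)
  case 0
  then show ?case using b by (simp add: c_def)
next
  case (Suc r)
  let ?c = "c r"
  from Suc have rl: "r \<le> length \<nu>" by simp
  from Suc have cb: "bracket_vector \<nu> ?c" and right: "\<And>j. j \<le> length \<nu> \<Longrightarrow> r \<le> j \<Longrightarrow> ?c ! j = b ! j"
    and left: "\<And>j. j < r \<Longrightarrow> (j \<in> descents \<nu> b \<longrightarrow> ?c ! j = eta \<nu> j b \<and> (\<forall>i<j. ?c ! i \<noteq> ?c ! j)) \<and>
      (j \<notin> descents \<nu> b \<longrightarrow> j \<notin> fixed_positions \<nu> \<longrightarrow>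
        ?c ! j = top_height \<nu> \<or> (\<exists>i<j. ?c ! i = ?c ! j))"
    by auto
  have cS: "c (Suc r) = Theta \<nu> r ?c" by (simp add: c_def)
  \<comment> \<open>Being a descent at \<open>r\<close> depends on the entries at \<open>r\<close>
    and \<open>Suc r\<close> alone, and neither has been changed yet.\<close>
  have desc: "r \<in> descents \<nu> ?c \<longleftrightarrow> r \<in> descents \<nu> b"
    using right[of r] right[of "Suc r"] by (auto simp: descents_def)
  have len: "r < length ?c" using bracket_vectorD(1)[OF cb] rl by simp
  \<comment> \<open>Each branch of \<open>Theta\<close> replaces the entry at \<open>r\<close> by
    some \<open>t\<close>; at a fixed position \<open>t\<close> is the old entry.\<close>
  have final: ?case if eq: "c (Suc r) = ?c[r := t]" and bv: "bracket_vector \<nu> (?c[r := t])"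
    and d: "r \<in> descents \<nu> b \<Longrightarrow> t = eta \<nu> r b \<and> (\<forall>i<r. ?c ! i \<noteq> t)"
    and nd: "r \<notin> descents \<nu> b \<Longrightarrow> r \<notin> fixed_positions \<nu> \<Longrightarrow>
      t = top_height \<nu> \<or> (\<exists>i<r. ?c ! i = t)" for t
  proof -
    have nth: "c (Suc r) ! j = (if j = r then t else ?c ! j)" for j
      unfolding eq using len by (simp add: nth_list_update)
    have "(j \<in> descents \<nu> b \<longrightarrow> c (Suc r) ! j = eta \<nu> j b \<and> (\<forall>i<j. c (Suc r) ! i \<noteq> c (Suc r) ! j)) \<and>
        (j \<notin> descents \<nu> b \<longrightarrow> j \<notin> fixed_positions \<nu> \<longrightarrow>
          c (Suc r) ! j = top_height \<nu> \<or> (\<exists>i<j. c (Suc r) ! i = c (Suc r) ! j))" if "j < Suc r" for j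
    proof (cases "j = r")
      case True
      then show ?thesis using d nd by (simp add: nth cong: conj_cong)
    next
      case False
      with that have j: "j < r" by simp
      then have "c (Suc r) ! i = ?c ! i" if "i \<le> j" for i using that by (simp add: nth)
      then show ?thesis using left[OF j] by (metis less_imp_le order_refl)
    qed
    moreover have "bracket_vector \<nu> (c (Suc r))" using bv eq by simp
    moreover have "\<forall>j\<le>length \<nu>. Suc r \<le> j \<longrightarrow> c (Suc r) ! j = b ! j"
      using right by (simp add: nth)
    ultimately show ?thesis by blast
  qed
  consider "r \<in> fixed_positions \<nu>" | "r \<notin> fixed_positions \<nu>" "r \<in> descents \<nu> b"
    | "r \<notin> fixed_positions \<nu>" "r \<notin> descents \<nu> b" by blast
  then show ?case
  proof cases
    case 1
    then have "c (Suc r) = ?c[r := ?c ! r]"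
      unfolding cS by (simp add: Theta_def fixed_positions_def)
    then show ?thesis
      using cb 1 descents_not_fixed(2)[OF b] by (intro final[of "?c ! r"]) auto
  next
    case 2
    then have dc: "r \<in> descents \<nu> ?c" using desc by simp
    have e: "eta \<nu> r ?c = eta \<nu> r b"
      using right bracket_vectorD(3)[OF b rl] rl by (intro eta_cong) auto
    \<comment> \<open>An earlier entry equal to this value would cover \<open>r\<close>, and nesting
      would bound \<open>?c ! r\<close> by \<open>eta\<close>, which is strictly smaller.\<close>
    have "?c ! i \<noteq> eta \<nu> r b" if "i < r" for i
      using bracket_vectorD(5)[OF cb that rl] eta_props(1,2)[OF cb dc] e by auto
    then show ?thesis
      using 2 bracket_vector_eta[OF cb dc] e dc
      by (intro final[of "eta \<nu> r b"]) (auto simp: cS Theta_def fixed_positions_def)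
  next
    case 3
    then show ?thesis
      using bracket_vector_zeta[OF cb rl] zeta_props(3)[OF cb rl] desc
      by (intro final[of "zeta \<nu> r ?c"]) (auto simp: cS Theta_def fixed_positions_def)
  qed
qed

theorem theorem4p2:
  fixes \<nu> :: path and l n :: nat and b :: "nat list"
  assumes "n \<le> l"
    and "lattice_point \<nu> (length \<nu>) = (l - n, n)"
    and "b \<in> carrier (Tam \<nu>)"
  shows "Row (Tam \<nu>) b = fold (Theta \<nu>) [0..<l + 1] b"
proof -
  \<comment> \<open>Serves to identify \<open>l\<close> with the number of steps;
    \<open>n \<le> l\<close> keeps the truncated subtraction \<open>l - n\<close> exact.\<close>
  have "length xs = count_list xs East + count_list xs North" for xs :: path
    by (induction xs) (auto, metis step.exhaust)
  then have l: "l = length \<nu>"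
    using assms(1,2) by (simp add: lattice_point_def)
  have b: "bracket_vector \<nu> b" using assms(3) by simp
  define y where "y = fold (Theta \<nu>) [0..<length \<nu> + 1] b"
  note inv = fold_Theta_invariant[OF b order_refl, folded y_def]
  from inv have y: "bracket_vector \<nu> y" by blast
  have desc: "y ! j = eta \<nu> j b" "i < j \<Longrightarrow> y ! i \<noteq> y ! j" if "j \<in> descents \<nu> b" for i j
    using inv descents_not_fixed(1)[OF b that] that by (auto simp only: less_Suc_eq_le Suc_eq_plus1[symmetric])
  have nondesc: "y ! j = top_height \<nu> \<or> (\<exists>i<j. y ! i = y ! j)"
    if "j \<le> length \<nu>" "j \<notin> descents \<nu> b" "j \<notin> fixed_positions \<nu>" for j
    using inv that by (auto simp only: less_Suc_eq_le Suc_eq_plus1[symmetric])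
  have "y ! j < top_height \<nu>" if "j \<in> descents \<nu> b" for j
    using desc(1)[OF that] eta_props(2)[OF b that] bracket_vectorD(3)[OF b, of j]
      descents_not_fixed(1)[OF b that] by simp
  \<comment> \<open>At descents of \<open>b\<close> the values are new and below
    \<open>top_height \<nu>\<close>; at every other non-fixed position one of these two properties
    fails.\<close>
  then have "raisable \<nu> y = descents \<nu> b"
    using desc nondesc descents_not_fixed[OF b] by (fastforce simp: raisable_def)
  then have "up_labels (Tam \<nu>) y = down_labels (Tam \<nu>) b"
    unfolding up_labels_Tam[OF y] down_labels_Tam[OF b] using desc(1) by (auto intro!: image_cong)
  then have "Row (Tam \<nu>) b = y"
    unfolding Row_def Tam_simps
    using y up_labels_inject[OF _ y] by (intro the_equality) metis+
  then show ?thesis by (simp only: y_def l)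
qed

end
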